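(* For every fixed integer $m\ge 1$, \[\lim_{n\to\infty}\frac{sat(Q_n,Q_m)}{e(Q_n)}=0.\]
   Context: $Q_n$ is the $n$-dimensional hypercube: vertex set $\{0,1\}^n$, two vertices adjacent iff they differ in exactly one coordinate; $e(Q_n)=n2^{n-1}$ is its number of edges. A copy of a graph $F$ in a graph $G$ is a subgraph of $G$ isomorphic to $F$; $G$ is $F$-free if it contains no copy of $F$. A graph $G$ is $(Q_n,F)$-saturated if $G$ is a subgraph of $Q_n$ (on vertex set $\{0,1\}^n$), $G$ is $F$-free, and adding to $G$ any edge of $E(Q_n)\setminus E(G)$ creates a copy of $F$ (i.e. $G$ is a maximal $F$-free subgraph of $Q_n$). $sat(Q_n,F)$ is the minimum number of edges of a $(Q_n,F)$-saturated graph. *)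

theory Defs
  imports Complex_Main
begin

text \<open>Vertices of Q_n: subsets of {0..<n} (characteristic sets of 0/1-vectors).
  Edges: unordered pairs {A,B} of vertices whose symmetric difference has exactly one element.\<close>

definition hc_verts :: "nat \<Rightarrow> nat set set" where
  "hc_verts n = {A. A \<subseteq> {..<n}}"

definition hc_edges :: "nat \<Rightarrow> nat set set set" where
  "hc_edges n = {{A, B} | A B. A \<in> hc_verts n \<and> B \<in> hc_verts n \<and>
                               card ((A - B) \<union> (B - A)) = 1}"

definition has_copy :: "'a set \<Rightarrow> 'a set set \<Rightarrow> 'b set \<Rightarrow> 'b set set \<Rightarrow> bool" where
  "has_copy VF EF VG EG \<longleftrightarrow>
     (\<exists>f. inj_on f VF \<and> f ` VF \<subseteq> VG \<and> (\<forall>e\<in>EF. f ` e \<in> EG))"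

definition sat_graph :: "nat \<Rightarrow> nat \<Rightarrow> nat set set set \<Rightarrow> bool" where
  "sat_graph n m E \<longleftrightarrow>
     E \<subseteq> hc_edges n \<and>
     \<not> has_copy (hc_verts m) (hc_edges m) (hc_verts n) E \<and>
     (\<forall>e \<in> hc_edges n - E. has_copy (hc_verts m) (hc_edges m) (hc_verts n) (insert e E))"

definition sat_num :: "nat \<Rightarrow> nat \<Rightarrow> nat" where
  "sat_num n m = Min {card E | E. sat_graph n m E}"

end

theory Submission
  imports Defs
begin

text \<open>
  It suffices to find a sparse \<open>Q\<^sub>m\<close>-free skeleton such that adding almost any edge creates a copy
  of \<open>Q\<^sub>m\<close>: every maximal \<open>Q\<^sub>m\<close>-free extension then contains only few further edges.

  Reserve \<open>2(m - 1)\<close> blocks of \<open>K = 2\<^sup>k\<close> coordinates, split into two families of \<open>m - 1\<close> blocks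
  by the parity of the block index, and put a Hamming code of density \<open>1/K\<close> into each block. The edges
  in the remaining directions are split into two classes, each free of 4-cycles, by the parity of
  their level. The skeleton contains the edges of class \<open>c\<close> at those vertices that project to a
  codeword in some block of family \<open>c\<close> and in no block of the other family, and, inside the blocks
  of family \<open>c\<close>, the edges joining codewords to non-codewords as long as the vertex has no
  codeword in the other family.

  If a vertex \<open>A\<close> has no codeword at all, then the \<open>m - 1\<close> directions correcting \<open>A\<close> in the blocks
  of family \<open>c\<close>, together with the direction of a class \<open>c\<close> edge at \<open>A\<close>, span an \<open>m\<close>-cube that
  misses only this edge. Conversely, a copy of \<open>Q\<^sub>m\<close> in the skeleton would be a subcube using at most
  one direction per block, blocks of one family only and at most one remaining direction, hence
  all \<open>m - 1\<close> blocks of a family; but then one of its vertices has no codeword, and there the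
  remaining direction is not available.
\<close>

section \<open>Copies of cubes are subcubes\<close>

lemma hc_edges_eq:
  "hc_edges n = {{A, sym_diff A {i}} | A i. A \<subseteq> {..<n} \<and> i < n}" (is "_ = ?R")
proof (intro equalityI subsetI)
  fix e assume "e \<in> hc_edges n"
  then obtain A B where AB: "e = {A, B}" "A \<subseteq> {..<n}" "B \<subseteq> {..<n}"
    "card (sym_diff A B) = 1"
    unfolding hc_edges_def hc_verts_def by blast
  then obtain i where i: "sym_diff A B = {i}" by (auto simp: card_1_singleton_iff)
  have "B = sym_diff A {i}" using i by blast
  moreover have "i < n" using i AB(2,3) by blast
  ultimately show "e \<in> ?R" using AB by blast
next
  fix e assume "e \<in> ?R"
  then obtain A i where A: "e = {A, sym_diff A {i}}" "A \<subseteq> {..<n}" "i < n" by blast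
  have "sym_diff A (sym_diff A {i}) = {i}" by blast
  hence "card (sym_diff A (sym_diff A {i})) = 1" by simp
  moreover have "sym_diff A {i} \<subseteq> {..<n}" using A by blast
  ultimately show "e \<in> hc_edges n"
    unfolding hc_edges_def hc_verts_def using A by blast
qed

lemma hc_edgesI: "A \<subseteq> {..<n} \<Longrightarrow> i < n \<Longrightarrow> {A, sym_diff A {i}} \<in> hc_edges n"
  unfolding hc_edges_eq by blast

lemma hc_edgesE:
  assumes "e \<in> hc_edges n"
  obtains A i where "A \<subseteq> {..<n}" "i < n" "e = {A, sym_diff A {i}}"
  using assms unfolding hc_edges_eq by blast

text \<open>Two vertices at distance two, here \<open>sym_diff P {a}\<close> and
  \<open>sym_diff P {b}\<close>, have only two common neighbours: \<open>P\<close> and the opposite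
  corner of the square.\<close>

lemma sym_diff_singletons_cases:
  assumes "sym_diff (sym_diff P {a}) {i} = sym_diff (sym_diff P {b}) {j}" "a \<noteq> b"
  shows "i = b \<or> sym_diff (sym_diff P {a}) {i} = P"
proof -
  have "sym_diff {a} {i} = sym_diff {b} {j}"
    using assms(1) by (simp add: set_eq_iff) metis
  thus ?thesis using assms(2) by blast
qed

lemma sym_diff_insert2:
  assumes "a \<notin> G" "b \<notin> G" "a \<noteq> b"
  shows "sym_diff (sym_diff (sym_diff F G) {b}) {a} = sym_diff F (G \<union> {a, b})"
proof (rule set_eqI)
  fix x show "x \<in> sym_diff (sym_diff (sym_diff F G) {b}) {a} \<longleftrightarrow> x \<in> sym_diff F (G \<union> {a, b})"
    using assms by (cases "x = a"; cases "x = b"; cases "x \<in> G"; cases "x \<in> F"; simp)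
qed

text \<open>Induction on the size of \<open>X\<close>: for distinct \<open>j\<close>,
  \<open>j'\<close> in \<open>X\<close>, the vertex \<open>f X\<close> is a common neighbour of the
  images of \<open>X - {j}\<close> and \<open>X - {j'}\<close>. Injectivity rules out the image of
  \<open>X - {j, j'}\<close>, so \<open>f X\<close> is the opposite corner of that square. Thus
  parallel edges of the cube keep a common direction \<open>g j\<close>.\<close>

lemma cube_embedding_affine:
  assumes inj: "inj_on f (hc_verts m)"
    and adj: "\<And>e. e \<in> hc_edges m \<Longrightarrow> f ` e \<in> hc_edges n"
  obtains g where "inj_on g {..<m}" "g ` {..<m} \<subseteq> {..<n}"
    "\<And>X. X \<subseteq> {..<m} \<Longrightarrow> f X = sym_diff (f {}) (g ` X)"
proof -
  have step: "\<exists>i<n. f (sym_diff X {j}) = sym_diff (f X) {i}" if X: "X \<subseteq> {..<m}" "j < m" for X j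
  proof -
    from adj[OF hc_edgesI[OF X]] have "{f X, f (sym_diff X {j})} \<in> hc_edges n" by simp
    then obtain A i where A: "i < n" "{f X, f (sym_diff X {j})} = {A, sym_diff A {i}}"
      by (elim hc_edgesE)
    from A(2) consider "f X = A \<and> f (sym_diff X {j}) = sym_diff A {i}"
      | "f (sym_diff X {j}) = A \<and> f X = sym_diff A {i}"
      by (auto simp: doubleton_eq_iff)
    hence "f (sym_diff X {j}) = sym_diff (f X) {i}" by cases blast+
    thus ?thesis using A(1) by blast
  qed
  have "\<exists>i<n. f {j} = sym_diff (f {}) {i}" if "j < m" for j
    using step[of "{}" j] that by simp
  then obtain g where g: "\<And>j. j < m \<Longrightarrow> g j < n \<and> f {j} = sym_diff (f {}) {g j}" by metis
  have ginj: "inj_on g {..<m}"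
  proof (rule inj_onI)
    fix j j' assume j: "j \<in> {..<m}" "j' \<in> {..<m}" "g j = g j'"
    hence "f {j} = f {j'}" using g by simp
    moreover have "{j} \<in> hc_verts m" "{j'} \<in> hc_verts m" using j by (auto simp: hc_verts_def)
    ultimately have "{j} = {j'}" by (rule inj_onD[OF inj])
    thus "j = j'" by simp
  qed
  have main: "f X = sym_diff (f {}) (g ` X)" if "X \<subseteq> {..<m}" for X
    using that
  proof (induction "card X" arbitrary: X rule: less_induct)
    case less
    have fin: "finite X" using less.prems finite_subset by blast
    show ?case
    proof (cases "\<exists>j j'. j \<in> X \<and> j' \<in> X \<and> j \<noteq> j'")
      case False
      then consider "X = {}" | j where "X = {j}" by blast
      thus ?thesis
      proof cases
        case 2
        thus ?thesis using g less.prems by simp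
      qed simp
    next
      case True
      then obtain j j' where j: "j \<in> X" "j' \<in> X" "j \<noteq> j'" by blast
      define Y where "Y = X - {j, j'}"
      have jm: "j < m" "j' < m" using j less.prems by auto
      have gne: "g j \<noteq> g j'" using ginj j(3) jm by (auto simp: inj_on_def)
      have gX: "g ` X = g ` Y \<union> {g j, g j'}" unfolding Y_def using j by blast
      have gY: "g j \<notin> g ` Y" "g j' \<notin> g ` Y"
        unfolding Y_def using ginj jm less.prems by (auto simp: inj_on_def)
      have sub: "Y \<subset> X" "X - {j} \<subset> X" "X - {j'} \<subset> X" using j Y_def by auto
      define P where "P = f Y"
      have P: "P = sym_diff (f {}) (g ` Y)"
        unfolding P_def using less sub(1) fin by (meson psubset_card_mono psubset_imp_subset subset_trans)
      have e1: "g ` (X - {j}) = g ` Y \<union> {g j'}" unfolding Y_def using j by blast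
      have e2: "g ` (X - {j'}) = g ` Y \<union> {g j}" unfolding Y_def using j by blast
      have "f (X - {j}) = sym_diff (f {}) (g ` (X - {j}))"
        using less sub(2) fin by (meson psubset_card_mono psubset_imp_subset subset_trans)
      hence f1: "f (X - {j}) = sym_diff P {g j'}" unfolding e1 P using gY by blast
      have "f (X - {j'}) = sym_diff (f {}) (g ` (X - {j'}))"
        using less sub(3) fin by (meson psubset_card_mono psubset_imp_subset subset_trans)
      hence f2: "f (X - {j'}) = sym_diff P {g j}" unfolding e2 P using gY by blast
      have X1: "sym_diff (X - {j}) {j} = X" "sym_diff (X - {j'}) {j'} = X" using j by auto
      obtain i where i: "f X = sym_diff (f (X - {j})) {i}"
        using step[of "X - {j}" j] X1(1) jm less.prems by (metis Diff_subset subset_trans)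
      obtain i' where i': "f X = sym_diff (f (X - {j'})) {i'}"
        using step[of "X - {j'}" j'] X1(2) jm less.prems by (metis Diff_subset subset_trans)
      have "f X \<noteq> P"
        unfolding P_def using inj sub(1) less.prems by (auto simp: inj_on_def hc_verts_def)
      with sym_diff_singletons_cases[of P "g j'" i "g j" i'] i i' f1 f2 gne
      have "i = g j" by auto
      hence "f X = sym_diff (sym_diff P {g j'}) {g j}" using i f1 by simp
      also have "\<dots> = sym_diff (f {}) (g ` X)" unfolding gX P using gY gne by (rule sym_diff_insert2)
      finally show ?thesis .
    qed
  qed
  show ?thesis
  proof (rule that[of g])
    show "g ` {..<m} \<subseteq> {..<n}" using g by blast
  qed (use ginj main in blast)+
qed

section \<open>Saturated extensions\<close>

lemma has_copyE:
  assumes "has_copy VF EF VG EG"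
  obtains f where "inj_on f VF" "f ` VF \<subseteq> VG" "\<And>e. e \<in> EF \<Longrightarrow> f ` e \<in> EG"
proof -
  obtain f where f: "inj_on f VF \<and> f ` VF \<subseteq> VG \<and> (\<forall>e\<in>EF. f ` e \<in> EG)"
    using assms unfolding has_copy_def by (rule exE)
  show thesis by (rule that[of f]) (use f in simp_all)
qed

lemma has_copy_mono: 
  assumes "has_copy VF EF VG E" "E \<subseteq> E'" shows "has_copy VF EF VG E'"
proof -
  obtain f where "inj_on f VF" "f ` VF \<subseteq> VG" "\<forall>e\<in>EF. f ` e \<in> E"
    using assms(1) unfolding has_copy_def by (elim exE conjE)
  moreover from this(3) have "\<forall>e\<in>EF. f ` e \<in> E'" using assms(2) by blast
  ultimately show ?thesis unfolding has_copy_def by (intro exI[of _ f] conjI)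
qed

lemma finite_hc_edges: "finite (hc_edges n)"
proof -
  have "hc_edges n \<subseteq> Pow (Pow {..<n})" unfolding hc_edges_def hc_verts_def by blast
  thus ?thesis by (rule finite_subset) simp
qed

text \<open>Among the finitely many \<open>Q_m\<close>-free graphs between \<open>E0\<close> and the
  hypercube take a maximal one; its maximality is saturation.\<close>

lemma sat_extension:
  assumes "E0 \<subseteq> hc_edges n" "\<not> has_copy (hc_verts m) (hc_edges m) (hc_verts n) E0"
  obtains E where "E0 \<subseteq> E" "sat_graph n m E"
proof -
  let ?S = "{E. E0 \<subseteq> E \<and> E \<subseteq> hc_edges n \<and> \<not> has_copy (hc_verts m) (hc_edges m) (hc_verts n) E}"
  have "finite ?S" by (rule finite_subset[of _ "Pow (hc_edges n)"]) (auto simp: finite_hc_edges)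
  moreover have "E0 \<in> ?S" using assms by simp
  ultimately obtain E where E: "E \<in> ?S" and max: "\<forall>E'\<in>?S. E \<subseteq> E' \<longrightarrow> E = E'"
    using finite_has_maximal[of ?S] by (metis (lifting) empty_iff)
  have "has_copy (hc_verts m) (hc_edges m) (hc_verts n) (insert e E)"
    if "e \<in> hc_edges n - E" for e
  proof (rule ccontr)
    assume "\<not> ?thesis"
    hence "insert e E \<in> ?S" using E that by simp blast
    from bspec[OF max this] have "E = insert e E" by (simp add: subset_insertI)
    thus False using that by blast
  qed
  hence "sat_graph n m E" unfolding sat_graph_def using E by blast
  thus ?thesis using that E by blast
qed

lemma sat_num_le:
  assumes "sat_graph n m E"
  shows "sat_num n m \<le> card E"
proof -
  have "finite {E. sat_graph n m E}"
    by (rule finite_subset[of _ "Pow (hc_edges n)"]) (auto simp: finite_hc_edges sat_graph_def)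
  hence "finite {card E | E. sat_graph n m E}" by (simp add: setcompr_eq_image)
  thus ?thesis unfolding sat_num_def using assms by (auto intro: Min_le)
qed

section \<open>Hamming codes in blocks of coordinates\<close>

definition block :: "nat \<Rightarrow> nat \<Rightarrow> nat set" where
  "block K b = {i. i div K = b}"

text \<open>For \<open>K = 2^k\<close> the parity check columns of a block are all
  \<open>k\<close>-bit numbers, 0 included, each occurring once. Hence any syndrome turns into any
  prescribed one by a single flip in the block.\<close>

definition syndrome :: "nat \<Rightarrow> nat \<Rightarrow> nat set \<Rightarrow> nat" where
  "syndrome K b A = Finite_Set.fold (\<lambda>i. xor (i mod K)) 0 (A \<inter> block K b)"

lemma xor_eq_0_iff: "xor a b = 0 \<longleftrightarrow> a = b" for a b :: nat
proof
  assume "xor a b = 0"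
  have "a = xor a (xor b b)" by simp
  also have "\<dots> = xor (xor a b) b" by (simp only: xor.assoc)
  finally show "a = b" using \<open>xor a b = 0\<close> by simp
qed simp

lemma comp_fun_commute_xor: "comp_fun_commute (\<lambda>i. xor (i mod K :: nat))"
  by (rule comp_fun_commute.intro, rule ext, simp only: comp_apply xor.left_commute)

lemma syndrome_cong:
  "A \<inter> block K b = A' \<inter> block K b \<Longrightarrow> syndrome K b A = syndrome K b A'"
  unfolding syndrome_def by simp

lemma syndrome_flip:
  assumes "finite A" "i div K = b"
  shows "syndrome K b (sym_diff A {i}) = xor (i mod K) (syndrome K b A)"
proof -
  interpret comp_fun_commute "\<lambda>i. xor (i mod K)"
    by (rule comp_fun_commute_xor)
  have i: "i \<in> block K b" using assms(2) by (simp add: block_def)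
  have ins: "syndrome K b (insert i B) = xor (i mod K) (syndrome K b B)" if "finite B" "i \<notin> B" for B
  proof -
    have "insert i B \<inter> block K b = insert i (B \<inter> block K b)" using i by blast
    thus ?thesis unfolding syndrome_def using that by simp
  qed
  show ?thesis
  proof (cases "i \<in> A")
    case True
    define B where "B = A - {i}"
    have "A = insert i B" "sym_diff A {i} = B" "i \<notin> B" "finite B"
      using True assms(1) B_def by auto
    thus ?thesis using ins[of B] by (metis xor.assoc xor.left_neutral xor_self_eq)
  next
    case False
    hence "sym_diff A {i} = insert i A" by blast
    thus ?thesis using ins[OF assms(1) False] by simp
  qed
qed

text \<open>Numbers of at most \<open>k\<close> bits are closed under \<open>xor\<close>. It ensures
  that the position correcting a syndrome exists inside the block.\<close>

lemma syndrome_less: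
  assumes "finite A"
  shows "syndrome (2 ^ k) b A < 2 ^ k"
proof -
  interpret comp_fun_commute "\<lambda>i. xor (i mod (2 ^ k)) :: nat \<Rightarrow> nat"
    by (rule comp_fun_commute_xor)
  have "Finite_Set.fold (\<lambda>i. xor (i mod (2 ^ k))) 0 B < (2 ^ k :: nat)" if "finite B" for B :: "nat set"
    using that
  proof (induction B)
    case (insert x B)
    \<comment> \<open>Truncation to \<open>k\<close> bits fixes the numbers below
      \<open>2 ^ k\<close> and commutes with \<open>xor\<close>.\<close>
    have "xor (x mod 2 ^ k) y < 2 ^ k" if "y < 2 ^ k" for y :: nat
      using that by (metis take_bit_nat_eq_self take_bit_nat_less_exp take_bit_xor take_bit_eq_mod mod_mod_trivial)
    thus ?case using insert by simp
  qed simp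
  thus ?thesis unfolding syndrome_def using assms by simp
qed

text \<open>The \<open>2 ^ k\<close> translates of the code by single flips in the block are
  disjoint, because the syndrome of a translated codeword reveals the flipped position.\<close>

lemma card_codewords_le:
  assumes "(b + 1) * 2 ^ k \<le> n"
  shows "2 ^ k * card {A. A \<subseteq> {..<n} \<and> syndrome (2 ^ k) b A = 0} \<le> 2 ^ n"
proof -
  let ?K = "2 ^ k :: nat"
  let ?H = "{A. A \<subseteq> {..<n} \<and> syndrome ?K b A = 0}"
  let ?T = "\<lambda>(r, A). sym_diff A {b * ?K + r}"
  have dm: "(b * ?K + r) div ?K = b" "(b * ?K + r) mod ?K = r" if "r < ?K" for r
    using that by auto
  have syn: "syndrome ?K b (sym_diff A {b * ?K + r}) = r" if "A \<in> ?H" "r < ?K" for A r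
    using that dm[OF that(2)] syndrome_flip[of A "b * ?K + r" ?K b] finite_subset[of A "{..<n}"] by simp
  have "inj_on ?T ({..<?K} \<times> ?H)"
  proof (rule inj_onI)
    fix p p' assume p: "p \<in> {..<?K} \<times> ?H" "p' \<in> {..<?K} \<times> ?H" "?T p = ?T p'"
    obtain r A r' A' where pp: "p = (r, A)" "p' = (r', A')" by fastforce
    have eq: "sym_diff A {b * ?K + r} = sym_diff A' {b * ?K + r'}" using p(3) pp by simp
    have "r = r'" using syn[of A r] syn[of A' r'] p pp eq by simp
    moreover from this have "A = A'" using eq by blast
    ultimately show "p = p'" using pp by simp
  qed
  moreover have "?T ` ({..<?K} \<times> ?H) \<subseteq> Pow {..<n}"
  proof (rule image_subsetI)
    fix p assume "p \<in> {..<?K} \<times> ?H"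
    then obtain r A where p: "p = (r, A)" "r < ?K" "A \<subseteq> {..<n}" by auto
    moreover have "b * ?K + r < n" using p(2) assms by (simp add: algebra_simps)
    ultimately show "?T p \<in> Pow {..<n}" by auto
  qed
  ultimately have "card ({..<?K} \<times> ?H) \<le> card (Pow {..<n})"
    by (rule card_inj_on_le) simp
  thus ?thesis by (simp add: card_cartesian_product card_Pow)
qed

section \<open>The skeleton\<close>

text \<open>Block \<open>b\<close> belongs to family \<open>b mod 2\<close>, and coordinate \<open>i\<close> is a check position with syndrome
  \<open>i mod K\<close> in block \<open>i div K\<close>; the position with syndrome 0 is redundant.\<close>

definition covered :: "nat \<Rightarrow> nat \<Rightarrow> nat \<Rightarrow> nat set \<Rightarrow> bool" where
  "covered m K c A \<longleftrightarrow> (\<exists>b<2 * (m - 1). b mod 2 = c \<and> syndrome K b A = 0)"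

text \<open>The count leaves out \<open>i\<close> so that both ends of an edge in direction
  \<open>i\<close> get the same class, and leaves out the block coordinates so that flips there
  preserve the class.\<close>

definition skel_adj :: "nat \<Rightarrow> nat \<Rightarrow> nat set \<Rightarrow> nat \<Rightarrow> bool" where
  "skel_adj m K A i \<longleftrightarrow>
    (if i div K < 2 * (m - 1)
     then (syndrome K (i div K) A = 0) \<noteq> (syndrome K (i div K) (sym_diff A {i}) = 0)
        \<and> \<not> covered m K (1 - i div K mod 2) A
     else \<exists>c<2. covered m K c A \<and> \<not> covered m K (1 - c) A
        \<and> card {x \<in> A. 2 * (m - 1) \<le> x div K \<and> x \<noteq> i} mod 2 = c)"

definition skeleton :: "nat \<Rightarrow> nat \<Rightarrow> nat \<Rightarrow> nat set set set" where
  "skeleton m K n =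
    (\<lambda>(A, i). {A, sym_diff A {i}}) ` {(A, i). A \<subseteq> {..<n} \<and> i < n \<and> skel_adj m K A i}"

section \<open>Effect of flips on syndromes, coverage and adjacency\<close>

lemma sym_diff_image_block:
  assumes "\<And>l. l \<in> X \<Longrightarrow> g l div K \<noteq> b"
  shows "sym_diff A (g ` X) \<inter> block K b = A \<inter> block K b"
  using assms unfolding block_def by auto

lemma sym_diff_image_block_single:
  assumes "j \<in> X" "\<And>l. l \<in> X \<Longrightarrow> l \<noteq> j \<Longrightarrow> g l div K \<noteq> b"
  shows "sym_diff A (g ` X) \<inter> block K b = sym_diff A {g j} \<inter> block K b"
proof -
  have "g ` X \<inter> block K b = {g j} \<inter> block K b" using assms unfolding block_def by auto
  thus ?thesis by blast
qed

lemma sym_diff_image_flip: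
  assumes "inj_on g S" "X \<subseteq> S" "j \<in> S"
  shows "sym_diff F (g ` sym_diff X {j}) = sym_diff (sym_diff F (g ` X)) {g j}"
proof -
  have "g ` sym_diff X {j} = sym_diff (g ` X) {g j}"
    using assms by (auto simp: inj_on_def)
  moreover have "sym_diff F (sym_diff G {a}) = sym_diff (sym_diff F G) {a}" for G a by blast
  ultimately show ?thesis by simp
qed

lemma syndrome_flip_other:
  assumes "i div K \<noteq> b"
  shows "syndrome K b (sym_diff A {i}) = syndrome K b A"
  by (rule syndrome_cong) (use assms in \<open>auto simp: block_def\<close>)

lemma not_coveredD:
  "\<not> covered m K c A \<Longrightarrow> b < 2 * (m - 1) \<Longrightarrow> b mod 2 = c \<Longrightarrow> syndrome K b A \<noteq> 0"
  unfolding covered_def by simp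

lemma mod_2_neq_iff: "a mod 2 \<noteq> b mod 2 \<longleftrightarrow> a mod 2 = 1 - b mod 2" for a b :: nat
  by presburger

lemma covered_cong:
  assumes "\<And>b. b < 2 * (m - 1) \<Longrightarrow> b mod 2 = c \<Longrightarrow> syndrome K b A = syndrome K b A'"
  shows "covered m K c A = covered m K c A'"
  unfolding covered_def using assms by auto

lemma covered_flip:
  assumes "i div K < 2 * (m - 1) \<Longrightarrow> i div K mod 2 \<noteq> c"
  shows "covered m K c (sym_diff A {i}) = covered m K c A"
  by (rule covered_cong) (use assms in \<open>auto intro!: syndrome_flip_other\<close>)

text \<open>A flip in a block leaves the coverage by the other family alone, and a flip outside the
  blocks moves no syndrome. So adjacency can be read off from either end of an unordered
  edge.\<close>

lemma skel_adj_flip: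
  "skel_adj m K (sym_diff A {i}) i \<longleftrightarrow> skel_adj m K A i"
proof (cases "i div K < 2 * (m - 1)")
  case True
  have flip2: "sym_diff (sym_diff A {i}) {i} = A" by blast
  have cov: "covered m K (1 - i div K mod 2) (sym_diff A {i}) = covered m K (1 - i div K mod 2) A"
    by (rule covered_flip) (use mod_2_neq_iff in blast)
  show ?thesis unfolding skel_adj_def if_P[OF True] cov flip2 by argo
next
  case False
  have "covered m K c (sym_diff A {i}) = covered m K c A" for c
    by (rule covered_flip) (use False in simp)
  moreover have "{x \<in> sym_diff A {i}. 2 * (m - 1) \<le> x div K \<and> x \<noteq> i} =
      {x \<in> A. 2 * (m - 1) \<le> x div K \<and> x \<noteq> i}" by blast
  ultimately show ?thesis using False unfolding skel_adj_def by simp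
qed

lemma skeleton_subset: "skeleton m K n \<subseteq> hc_edges n"
  unfolding skeleton_def by (auto intro: hc_edgesI)

lemma skeletonI:
  "A \<subseteq> {..<n} \<Longrightarrow> i < n \<Longrightarrow> skel_adj m K A i \<Longrightarrow> {A, sym_diff A {i}} \<in> skeleton m K n"
  unfolding skeleton_def by (intro image_eqI[of _ _ "(A, i)"]) auto

lemma skeletonD:
  assumes "{A, sym_diff A {i}} \<in> skeleton m K n"
  shows "skel_adj m K A i"
proof -
  obtain A' i' where A': "{A, sym_diff A {i}} = {A', sym_diff A' {i'}}" "skel_adj m K A' i'"
    using assms unfolding skeleton_def by auto
  from A'(1) consider "A = A'" "sym_diff A {i} = sym_diff A' {i'}"
    | "A = sym_diff A' {i'}" "sym_diff A {i} = A'"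
    by (auto simp: doubleton_eq_iff)
  thus ?thesis
  proof cases
    case 1
    hence "i = i'" by blast
    thus ?thesis using 1 A' by simp
  next
    case 2
    hence "i = i'" by blast
    thus ?thesis using 2(1) A'(2) skel_adj_flip by simp
  qed
qed

section \<open>Squares and cubes in the skeleton\<close>

lemma skel_adj_square:
  assumes "finite A" "i \<noteq> i'"
    and "skel_adj m K A i" "skel_adj m K (sym_diff A {i'}) i"
    and "skel_adj m K A i'" "skel_adj m K (sym_diff A {i}) i'"
  shows "i div K < 2 * (m - 1) \<or> i' div K < 2 * (m - 1)"
    and "i div K < 2 * (m - 1) \<Longrightarrow> i' div K < 2 * (m - 1) \<Longrightarrow>
      i div K \<noteq> i' div K \<and> i div K mod 2 = i' div K mod 2"
proof -
  show "i div K < 2 * (m - 1) \<or> i' div K < 2 * (m - 1)"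
  proof (rule ccontr)
    \<comment> \<open>The edges in direction \<open>i\<close> at \<open>A\<close> and at
      \<open>sym_diff A {i'}\<close> see the same coverage and so need the same class, but flipping
      \<open>i'\<close> changes the parity of the level.\<close>
    assume rest: "\<not> ?thesis"
    hence r: "\<not> i div K < 2 * (m - 1)" by blast
    let ?S = "\<lambda>A. {x \<in> A. 2 * (m - 1) \<le> x div K \<and> x \<noteq> i}"
    have cov: "covered m K c (sym_diff A {i'}) = covered m K c A" for c
      by (rule covered_flip) (use rest in simp)
    obtain c where c: "c < 2" "covered m K c A" "\<not> covered m K (1 - c) A" "card (?S A) mod 2 = c"
      using assms(3) unfolding skel_adj_def if_not_P[OF r] by blast
    obtain c' where c': "c' < 2" "covered m K c' A" "\<not> covered m K (1 - c') A"
      "card (?S (sym_diff A {i'})) mod 2 = c'"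
      using assms(4) unfolding skel_adj_def cov if_not_P[OF r] by blast
    have "c = c'" using c c' by (cases "c = 0"; cases "c' = 0") (auto simp: less_2_cases_iff)
    moreover have "card (?S (sym_diff A {i'})) mod 2 \<noteq> card (?S A) mod 2"
    proof (cases "i' \<in> A")
      case True
      have "?S A = insert i' (?S (sym_diff A {i'}))" using True rest assms(2) by auto
      moreover have "i' \<notin> ?S (sym_diff A {i'})" using True by simp
      ultimately have "card (?S A) = Suc (card (?S (sym_diff A {i'})))" using assms(1) by simp
      thus ?thesis by presburger
    next
      case False
      have "?S (sym_diff A {i'}) = insert i' (?S A)" using False rest assms(2) by auto
      moreover have "i' \<notin> ?S A" using False by simp
      ultimately have "card (?S (sym_diff A {i'})) = Suc (card (?S A))" using assms(1) by simp
      thus ?thesis by presburger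
    qed
    ultimately show False using c c' by simp
  qed
  assume b: "i div K < 2 * (m - 1)" "i' div K < 2 * (m - 1)"
  let ?s = "syndrome K (i div K)" and ?s' = "syndrome K (i' div K)"
  have h: "(?s A = 0) \<noteq> (?s (sym_diff A {i}) = 0)" "(?s' A = 0) \<noteq> (?s' (sym_diff A {i'}) = 0)"
    "(?s' (sym_diff A {i}) = 0) \<noteq> (?s' (sym_diff (sym_diff A {i}) {i'}) = 0)"
    using assms(3,5,6) b unfolding skel_adj_def by simp_all
  have "i div K \<noteq> i' div K"
  proof
    \<comment> \<open>Edges alternate between codewords and non-codewords, so two opposite corners
      of the square would be codewords. They differ in two positions of the block with distinct
      residues, whose \<open>xor\<close> is nonzero.\<close>
    assume eq: "i div K = i' div K"
    have "i mod K \<noteq> i' mod K" using eq assms(2) by (metis div_mult_mod_eq)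
    moreover have s: "?s (sym_diff A {i}) = xor (i mod K) (?s A)"
      "?s (sym_diff A {i'}) = xor (i' mod K) (?s A)"
      "?s (sym_diff (sym_diff A {i}) {i'}) = xor (i' mod K) (xor (i mod K) (?s A))"
      using assms(1) eq by (simp_all add: syndrome_flip)
    ultimately show False using h unfolding eq[symmetric] s
      by (cases "?s A = 0") (auto simp: xor_eq_0_iff)
  qed
  moreover have "i div K mod 2 = i' div K mod 2"
  proof (rule ccontr)
    \<comment> \<open>The edges in direction \<open>i\<close> forbid codewords of the other family
      at both ends of the edge in direction \<open>i'\<close>, yet one of these ends is a codeword
      in the block of \<open>i'\<close>.\<close>
    assume par: "\<not> ?thesis"
    hence par': "i' div K mod 2 = 1 - i div K mod 2" using mod_2_neq_iff by metis
    have "\<not> covered m K (1 - i div K mod 2) A"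
      "\<not> covered m K (1 - i div K mod 2) (sym_diff A {i'})"
      using assms(3,4) b unfolding skel_adj_def by simp_all
    hence "?s' A \<noteq> 0" "?s' (sym_diff A {i'}) \<noteq> 0"
      using not_coveredD[OF _ b(2) par'] by simp_all
    thus False using h(2) by simp
  qed
  ultimately show "i div K \<noteq> i' div K \<and> i div K mod 2 = i' div K mod 2" ..
qed

text \<open>A copy is a subcube with fixed directions \<open>g j\<close>, so the squares at the
  single vertex \<open>F\<close> already restrict all pairs of directions. The contradiction then
  comes from another vertex of the subcube, \<open>V X\<close>.\<close>

lemma skeleton_free:
  assumes "m \<ge> 1"
  shows "\<not> has_copy (hc_verts m) (hc_edges m) (hc_verts n) (skeleton m K n)"
proof
  let ?B = "2 * (m - 1)"
  assume "has_copy (hc_verts m) (hc_edges m) (hc_verts n) (skeleton m K n)"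
  then obtain f where f: "inj_on f (hc_verts m)" "f ` hc_verts m \<subseteq> hc_verts n"
    "\<And>e. e \<in> hc_edges m \<Longrightarrow> f ` e \<in> skeleton m K n"
    by (rule has_copyE) blast
  have "\<And>e. e \<in> hc_edges m \<Longrightarrow> f ` e \<in> hc_edges n" using f(3) skeleton_subset by blast
  then obtain g where g: "inj_on g {..<m}" "g ` {..<m} \<subseteq> {..<n}"
    "\<And>X. X \<subseteq> {..<m} \<Longrightarrow> f X = sym_diff (f {}) (g ` X)"
    by (rule cube_embedding_affine[OF f(1)]) blast+
  define F where "F = f {}"
  define V where "V X = sym_diff F (g ` X)" for X
  have fV: "f X = V X" if "X \<subseteq> {..<m}" for X using g(3)[OF that] by (simp add: V_def F_def)
  have V0: "V {} = F" by (simp add: V_def)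
  have Vflip: "V (sym_diff X {j}) = sym_diff (V X) {g j}" if "X \<subseteq> {..<m}" "j < m" for X j
    unfolding V_def using sym_diff_image_flip[OF g(1) that(1)] that(2) by blast
  have V1: "V {j} = sym_diff F {g j}" if "j < m" for j
    by (simp add: V_def)
  have "{} \<in> hc_verts m" by (simp add: hc_verts_def)
  hence "F \<in> hc_verts n" using f(2) F_def by blast
  hence fin: "finite F" by (auto simp: hc_verts_def intro: finite_subset)
  have adj: "skel_adj m K (V X) (g j)" if "X \<subseteq> {..<m}" "j < m" for X j
  proof -
    have X': "sym_diff X {j} \<subseteq> {..<m}" using that by auto
    have "f ` {X, sym_diff X {j}} \<in> skeleton m K n" using f(3) hc_edgesI[OF that] by blast
    hence "{V X, sym_diff (V X) {g j}} \<in> skeleton m K n"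
      using fV[OF that(1)] fV[OF X'] Vflip[OF that] by simp
    thus ?thesis by (rule skeletonD)
  qed
  have adj0: "skel_adj m K F (g j)" if "j < m" for j
    using adj[of "{}" j] that V0 by simp
  have adj1: "skel_adj m K (sym_diff F {g j'}) (g j)" if "j < m" "j' < m" for j j'
    using adj[of "{j'}" j] that V1 by simp
  have gne: "g j \<noteq> g j'" if "j < m" "j' < m" "j \<noteq> j'" for j j'
    using g(1) that by (auto simp: inj_on_def)
  note sq = skel_adj_square[OF fin gne adj0 adj1 adj0 adj1]
  define J where "J = {j. j < m \<and> g j div K < ?B}"
  have Jm: "J \<subseteq> {..<m}" by (auto simp: J_def)
  have blocks: "g j div K \<noteq> g j' div K" "g j div K mod 2 = g j' div K mod 2"
    if "j \<in> J" "j' \<in> J" "j \<noteq> j'" for j j'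
    using sq(2)[of j j'] that by (auto simp: J_def)
  \<comment> \<open>The blocks used have indices of equal parity, so halving keeps them distinct and
    numbers them within the \<open>m - 1\<close> blocks of the family.\<close>
  define h where "h j = g j div K div 2" for j
  have hinj: "inj_on h J"
  proof (rule inj_onI, rule ccontr)
    fix j j' assume j: "j \<in> J" "j' \<in> J" "h j = h j'" "j \<noteq> j'"
    show False using blocks[OF j(1,2,4)] j(3) unfolding h_def by (metis div_mult_mod_eq)
  qed
  have hJ: "h ` J \<subseteq> {..<m - 1}" unfolding h_def J_def by auto
  have "card J \<le> m - 1" using card_inj_on_le[OF hinj hJ] by simp
  hence "J \<noteq> {..<m}" using assms by auto
  then obtain j0 where j0: "j0 < m" "j0 \<notin> J" using Jm by blast
  have J: "J = {..<m} - {j0}"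
  proof
    show "{..<m} - {j0} \<subseteq> J" using sq(1)[of j0] j0 by (auto simp: J_def)
  qed (use Jm j0 in blast)
  have "card J = m - 1" unfolding J using j0 by simp
  hence hsurj: "h ` J = {..<m - 1}"
    using card_image[OF hinj] hJ by (intro card_subset_eq) auto
  have rest: "\<not> g j0 div K < ?B" using j0 by (simp add: J_def)
  have "?B \<noteq> 0" using adj0[OF j0(1)] rest unfolding skel_adj_def covered_def by auto
  hence "0 \<in> h ` J" unfolding hsurj by simp
  then obtain j1 where j1: "j1 \<in> J" by blast
  have par: "g j div K mod 2 = g j1 div K mod 2" if "j \<in> J" for j
    using blocks(2)[OF that j1] by (cases "j = j1") auto
  \<comment> \<open>Flip exactly in the blocks that hold a codeword at \<open>F\<close>: each such
    flip leaves the code, and the other blocks of the family had no codeword. The other family has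
    none at \<open>F\<close> and is not touched.\<close>
  define X where "X = {j \<in> J. syndrome K (g j div K) F = 0}"
  have XJ: "X \<subseteq> J" by (auto simp: X_def)
  have free: "syndrome K b (V X) \<noteq> 0" if b: "b < ?B" for b
  proof (cases "b mod 2 = g j1 div K mod 2")
    case True
    have "b div 2 \<in> h ` J" unfolding hsurj using b by auto
    then obtain j where j: "j \<in> J" "h j = b div 2" by auto
    have gj: "g j div K = b" using par[OF j(1)] True j(2) unfolding h_def by (metis div_mult_mod_eq)
    have other: "g l div K \<noteq> b" if "l \<in> X" "l \<noteq> j" for l
      using blocks(1)[of l j] that j(1) XJ gj by auto
    show ?thesis
    proof (cases "j \<in> X")
      case True
      have "syndrome K b (V X) = syndrome K b (sym_diff F {g j})"
        unfolding V_def by (intro syndrome_cong sym_diff_image_block_single True other)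
      moreover have "syndrome K b F = 0" using True gj by (simp add: X_def)
      moreover have "(syndrome K b F = 0) \<noteq> (syndrome K b (sym_diff F {g j}) = 0)"
        using adj0[of j] j(1) gj unfolding skel_adj_def J_def by simp
      ultimately show ?thesis by simp
    next
      case False
      have "syndrome K b (V X) = syndrome K b F"
        unfolding V_def by (intro syndrome_cong sym_diff_image_block) (use other False in blast)
      thus ?thesis using False j(1) gj by (simp add: X_def)
    qed
  next
    case False
    have "g l div K \<noteq> b" if "l \<in> X" for l using par[of l] that XJ False by auto
    hence "syndrome K b (V X) = syndrome K b F"
      unfolding V_def by (intro syndrome_cong sym_diff_image_block)
    moreover have "\<not> covered m K (1 - g j1 div K mod 2) F"
      using adj0[of j1] j1 unfolding skel_adj_def J_def by simp
    moreover have "b mod 2 = 1 - g j1 div K mod 2" using False mod_2_neq_iff by blast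
    ultimately show ?thesis using b unfolding covered_def by auto
  qed
  have "skel_adj m K (V X) (g j0)" using adj[OF _ j0(1)] XJ Jm by blast
  moreover have "\<not> covered m K c (V X)" for c unfolding covered_def using free by blast
  ultimately show False unfolding skel_adj_def if_not_P[OF rest] by blast
qed

section \<open>Cubes completed by a single edge\<close>

lemma skeleton_completes:
  assumes m: "m \<ge> 1" and K: "K = 2 ^ k" and A: "A \<subseteq> {..<n}" "i < n"
    and rest: "2 * (m - 1) \<le> i div K"
    and free: "\<And>b. b < 2 * (m - 1) \<Longrightarrow> syndrome K b A \<noteq> 0"
  shows "has_copy (hc_verts m) (hc_edges m) (hc_verts n)
    (insert {A, sym_diff A {i}} (skeleton m K n))"
proof -
  let ?B = "2 * (m - 1)"
  define c where "c = card {x \<in> A. ?B \<le> x div K \<and> x \<noteq> i} mod 2"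
  have c2: "c < 2" by (simp add: c_def)
  \<comment> \<open>In block \<open>2 * j + c\<close>, the \<open>j\<close>-th of family
    \<open>c\<close>, pick the position whose residue equals the syndrome of \<open>A\<close>, so
    that flipping it yields a codeword. The last direction is that of the new edge, whose class is
    \<open>c\<close>.\<close>
  define g where "g j = (if j < m - 1 then (2 * j + c) * K + syndrome K (2 * j + c) A else i)" for j
  define V where "V X = sym_diff A (g ` X)" for X
  have finA: "finite A" using A(1) finite_subset by blast
  have syn: "syndrome K b A < K" for b using syndrome_less[OF finA] K by simp
  have gd: "g j div K = 2 * j + c" "g j mod K = syndrome K (2 * j + c) A" if "j < m - 1" for j
    using that syn[of "2 * j + c"] by (simp_all add: g_def)
  have gi: "g j = i" if "\<not> j < m - 1" for j using that by (simp add: g_def)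
  have gB: "g j div K < ?B" if "j < m - 1" for j using gd(1)[OF that] that c2 by linarith
  have gn: "g j < n" if "j < m" for j
  proof (cases "j < m - 1")
    \<comment> \<open>Block coordinates precede \<open>i\<close>, hence lie below
      \<open>n\<close>.\<close>
    case True
    have "g j div K < i div K" using gB[OF True] rest by linarith
    hence "g j < i" by (metis div_le_mono leD not_le_imp_less)
    thus ?thesis using A(2) by simp
  qed (use gi A(2) in simp)
  have ginj: "inj_on g {..<m}"
  proof (rule inj_onI)
    fix j j' assume j: "j \<in> {..<m}" "j' \<in> {..<m}" "g j = g j'"
    consider "j < m - 1" "j' < m - 1" | "j < m - 1" "j' = m - 1" | "j = m - 1" "j' < m - 1" | "j = j'"
      using j by fastforce
    thus "j = j'"
    proof cases
      case 1 thus ?thesis using gd(1)[OF 1(1)] gd(1)[OF 1(2)] unfolding j(3) by linarith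
    next
      case 2 thus ?thesis using gB[of j] gi[of j'] j(3) rest by simp
    next
      case 3 thus ?thesis using gB[of j'] gi[of j] j(3) rest by simp
    qed
  qed
  have Vn: "V X \<subseteq> {..<n}" if "X \<subseteq> {..<m}" for X
    unfolding V_def using A(1) gn that by auto
  have finV: "finite (V X)" if "X \<subseteq> {..<m}" for X using Vn[OF that] finite_subset by blast
  have gpar: "g l div K mod 2 = c \<or> ?B \<le> g l div K" for l
    using gd(1)[of l] gi[of l] c2 rest by (cases "l < m - 1") auto
  have gblock: "g l div K \<noteq> 2 * j + c" if "l \<noteq> j" "j < m - 1" for l j
  proof (cases "l < m - 1")
    case True thus ?thesis using gd(1) that by simp
  next
    case False thus ?thesis using gi[OF False] rest gB[OF that(2)] gd(1)[OF that(2)] by simp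
  qed
  have uncov: "\<not> covered m K (1 - c) (V X)" for X
  proof -
    have "syndrome K b (V X) \<noteq> 0" if b: "b < ?B" "b mod 2 = 1 - c" for b
    proof -
      have "b mod 2 \<noteq> c" using b(2) c2 by presburger
      hence "g l div K \<noteq> b" for l using gpar[of l] b(1) by auto
      hence "syndrome K b (V X) = syndrome K b A"
        unfolding V_def by (intro syndrome_cong sym_diff_image_block)
      thus ?thesis using free[OF b(1)] by simp
    qed
    thus ?thesis unfolding covered_def by blast
  qed
  \<comment> \<open>Each cube edge is viewed from its end with \<open>j\<close> not in
    \<open>X\<close>. For a block direction, the block then still has the nonzero syndrome of
    \<open>A\<close>, and the flip makes it 0.\<close>
  have adj: "{V X, sym_diff (V X) {g j}} \<in> insert {A, sym_diff A {i}} (skeleton m K n)"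
    if X: "X \<subseteq> {..<m}" and j: "j < m" "j \<notin> X" for X j
  proof (cases "j < m - 1")
    case True
    have "g l div K \<noteq> 2 * j + c" if "l \<in> X" for l
      by (rule gblock[OF _ True]) (use that j(2) in auto)
    hence "syndrome K (2 * j + c) (V X) = syndrome K (2 * j + c) A"
      unfolding V_def by (intro syndrome_cong sym_diff_image_block)
    moreover have "2 * j + c < ?B" using gB[OF True] gd(1)[OF True] by simp
    moreover have "(2 * j + c) mod 2 = c" using c2 by simp
    ultimately have "skel_adj m K (V X) (g j)"
      unfolding skel_adj_def using gd[OF True] uncov[of X] free[of "2 * j + c"]
        syndrome_flip[OF finV[OF X], of "g j" K "2 * j + c"] by simp
    thus ?thesis using skeletonI[OF Vn[OF X] gn[OF j(1)]] by blast
  next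
    case False
    have jm: "j = m - 1" "g j = i" using False j gi by auto
    show ?thesis
    \<comment> \<open>The empty set gives the added edge itself. Otherwise any \<open>l\<close> in
      \<open>X\<close> has produced a codeword of family \<open>c\<close>, while the class is still
      \<open>c\<close> because only block coordinates were flipped.\<close>
    proof (cases "X = {}")
      case True thus ?thesis using jm by (simp add: V_def)
    next
      case False
      then obtain l where l: "l \<in> X" by blast
      have Xm: "x < m - 1" if "x \<in> X" for x
      proof -
        have "x < m" "x \<noteq> m - 1" using X that jm(1) j(2) by auto
        thus ?thesis by simp
      qed
      have "syndrome K (2 * l + c) (V X) = syndrome K (2 * l + c) (sym_diff A {g l})"
        unfolding V_def by (intro syndrome_cong sym_diff_image_block_single l gblock Xm)
      also have "\<dots> = 0"
        using gd[OF Xm[OF l]] syndrome_flip[OF finA, of "g l" K "2 * l + c"] by simp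
      finally have "covered m K c (V X)"
        unfolding covered_def using gB[OF Xm[OF l]] gd(1)[OF Xm[OF l]] c2
        by (intro exI[of _ "2 * l + c"]) simp
      moreover have "{x \<in> V X. ?B \<le> x div K \<and> x \<noteq> i} = {x \<in> A. ?B \<le> x div K \<and> x \<noteq> i}"
      proof -
        have "\<not> ?B \<le> x div K" if "x \<in> g ` X" for x using that gB Xm by fastforce
        thus ?thesis unfolding V_def by blast
      qed
      ultimately have "skel_adj m K (V X) (g j)"
        unfolding skel_adj_def jm(2) using rest uncov[of X] c2 c_def by auto
      thus ?thesis using skeletonI[OF Vn[OF X] gn[OF j(1)]] by blast
    qed
  qed
  have "inj_on V (hc_verts m)"
  proof (rule inj_onI)
    fix X Y assume XY: "X \<in> hc_verts m" "Y \<in> hc_verts m" "V X = V Y"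
    have "g ` X = g ` Y" using XY(3) unfolding V_def by blast
    thus "X = Y" using inj_on_image_eq_iff[OF ginj] XY(1,2) by (simp add: hc_verts_def)
  qed
  moreover have "V ` hc_verts m \<subseteq> hc_verts n" using Vn by (auto simp: hc_verts_def)
  moreover have "V ` e \<in> insert {A, sym_diff A {i}} (skeleton m K n)" if "e \<in> hc_edges m" for e
  proof -
    obtain X j where Xj: "X \<subseteq> {..<m}" "j < m" "j \<notin> X" "e = {X, sym_diff X {j}}"
    proof -
      obtain X j where X: "X \<subseteq> {..<m}" "j < m" "e = {X, sym_diff X {j}}"
        using \<open>e \<in> hc_edges m\<close> by (rule hc_edgesE)
      show ?thesis
      proof (cases "j \<in> X")
        case True
        have "sym_diff (X - {j}) {j} = X" "sym_diff X {j} = X - {j}" using True by auto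
        thus ?thesis using that[of "X - {j}" j] X by (auto simp: insert_commute)
      qed (use that X in blast)
    qed
    have "V (sym_diff X {j}) = sym_diff (V X) {g j}"
      unfolding V_def using sym_diff_image_flip[OF ginj Xj(1)] Xj(2) by blast
    thus ?thesis using adj[OF Xj(1-3)] Xj(4) by simp
  qed
  ultimately show ?thesis unfolding has_copy_def by (intro exI[of _ V] conjI ballI)
qed

section \<open>Counting\<close>

text \<open>An edge of \<open>E\<close> runs in a block direction (\<open>?P\<close>) or can be
  written from an end with a codeword (\<open>?Q\<close>); otherwise it would complete a copy of
  \<open>Q_m\<close> with the skeleton inside \<open>E\<close>. The factor \<open>K\<close> matches
  the code bound and avoids division.\<close>

lemma card_saturated_le:
  assumes m: "m \<ge> 1" and K: "K = 2 ^ k" and n: "2 * (m - 1) * K \<le> n"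
    and E: "sat_graph n m E" "skeleton m K n \<subseteq> E"
  shows "K * card E \<le> K * (2 ^ n * (2 * (m - 1) * K)) + 2 * (m - 1) * 2 ^ n * n"
proof -
  let ?B = "2 * (m - 1)"
  let ?H = "\<lambda>b. {A. A \<subseteq> {..<n} \<and> syndrome K b A = 0}"
  let ?e = "\<lambda>(A, i). {A, sym_diff A {i}}"
  let ?P = "Pow {..<n} \<times> {..<?B * K}"
  let ?Q = "(\<Union>b<?B. ?H b) \<times> {..<n}"
  have Kpos: "K > 0" using K by simp
  have finH: "finite (?H b)" for b by (rule finite_subset[of _ "Pow {..<n}"]) auto
  have "E \<subseteq> ?e ` (?P \<union> ?Q)"
  proof
    fix e assume e: "e \<in> E"
    have "e \<in> hc_edges n" using E(1) e unfolding sat_graph_def by blast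
    then obtain A i where A: "A \<subseteq> {..<n}" "i < n" "e = {A, sym_diff A {i}}" by (rule hc_edgesE)
    have "(A, i) \<in> ?P \<union> ?Q"
    proof (rule ccontr)
      assume "(A, i) \<notin> ?P \<union> ?Q"
      hence "\<not> i < ?B * K" and free: "\<And>b. b < ?B \<Longrightarrow> syndrome K b A \<noteq> 0" using A(1,2) by auto
      hence "?B \<le> i div K" using Kpos by (simp add: less_eq_div_iff_mult_less_eq)
      from skeleton_completes[OF m K A(1,2) this free]
      have "has_copy (hc_verts m) (hc_edges m) (hc_verts n) (insert e (skeleton m K n))"
        using A(3) by simp
      hence "has_copy (hc_verts m) (hc_edges m) (hc_verts n) E"
        by (rule has_copy_mono) (use E(2) e in simp)
      thus False using E(1) unfolding sat_graph_def by simp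
    qed
    thus "e \<in> ?e ` (?P \<union> ?Q)" using A(3) by (intro image_eqI[of _ _ "(A, i)"]) simp_all
  qed
  moreover have finPQ: "finite (?P \<union> ?Q)" using finH by simp
  ultimately have "card E \<le> card (?P \<union> ?Q)" by (rule surj_card_le[rotated])
  also have "\<dots> \<le> card ?P + card ?Q" by (rule card_Un_le)
  also have "\<dots> \<le> 2 ^ n * (?B * K) + (\<Sum>b<?B. card (?H b)) * n"
  proof -
    have "card (\<Union>b<?B. ?H b) \<le> (\<Sum>b<?B. card (?H b))" by (rule card_UN_le) simp
    from mult_le_mono1[OF this, of n] show ?thesis by (simp add: card_cartesian_product card_Pow)
  qed
  finally have "K * card E \<le> K * (2 ^ n * (?B * K) + (\<Sum>b<?B. card (?H b)) * n)"
    by (rule mult_le_mono2)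
  also have "\<dots> = K * (2 ^ n * (?B * K)) + (\<Sum>b<?B. K * card (?H b)) * n"
    unfolding sum_distrib_left[symmetric] by (simp only: distrib_left mult.assoc)
  also have "(\<Sum>b<?B. K * card (?H b)) \<le> (\<Sum>b<?B. 2 ^ n)"
  proof (rule sum_mono)
    fix b assume "b \<in> {..<?B}"
    hence "(b + 1) * K \<le> ?B * K" by (intro mult_le_mono1) simp
    thus "K * card (?H b) \<le> 2 ^ n" using card_codewords_le[of b k n] n K by simp
  qed
  finally show ?thesis by simp
qed

text \<open>The first term accounts for block directions, the second for vertices with a codeword;
  \<open>m - 1\<close> is weakened to \<open>m\<close>, and \<open>2 ^ n\<close> is twice
  \<open>2 ^ (n - 1)\<close>.\<close>

lemma sat_num_ratio_le:
  assumes "m \<ge> 1" "2 * (m - 1) * 2 ^ k \<le> n" "n \<ge> 1"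
  shows "real (sat_num n m) / real (n * 2 ^ (n - 1))
    \<le> 4 * real m * 2 ^ k / real n + 4 * real m / 2 ^ k"
proof -
  let ?K = "2 ^ k :: nat"
  obtain E where E: "skeleton m ?K n \<subseteq> E" "sat_graph n m E"
    using sat_extension[OF skeleton_subset skeleton_free[OF assms(1)]] by blast
  have "?K * sat_num n m \<le> ?K * card E" using sat_num_le[OF E(2)] by simp
  also have "\<dots> \<le> ?K * (2 ^ n * (2 * (m - 1) * ?K)) + 2 * (m - 1) * 2 ^ n * n"
    by (rule card_saturated_le[OF assms(1) refl assms(2) E(2,1)])
  also have "\<dots> \<le> ?K * (2 ^ n * (2 * m * ?K)) + 2 * m * 2 ^ n * n"
    by (intro add_mono mult_le_mono) auto
  finally have "real (?K * sat_num n m) \<le> real (?K * (2 ^ n * (2 * m * ?K)) + 2 * m * 2 ^ n * n)"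
    by (rule of_nat_mono)
  moreover have "(2 ^ n :: real) = 2 * 2 ^ (n - 1)" using assms(3) by (cases n) auto
  ultimately show ?thesis using assms(3) by (simp add: field_simps)
qed

theorem theorem1:
  fixes m :: nat
  assumes "m \<ge> 1"
  shows "(\<lambda>n. real (sat_num n m) / real (n * 2 ^ (n - 1))) \<longlonglongrightarrow> 0"
proof (rule LIMSEQ_I)
  fix \<epsilon> :: real assume \<epsilon>: "\<epsilon> > 0"
  \<comment> \<open>First fix \<open>k\<close> to make the code density small; only then let
    \<open>n\<close> grow, so that the fixed number of block directions becomes negligible.\<close>
  have "(\<lambda>k. 4 * real m * (1 / 2) ^ k) \<longlonglongrightarrow> 4 * real m * 0"
    by (intro tendsto_intros LIMSEQ_power_zero) simp
  hence "eventually (\<lambda>k. 4 * real m * (1 / 2) ^ k < \<epsilon> / 2) sequentially"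
    by (rule order_tendstoD) (use \<epsilon> in simp)
  then obtain k where "4 * real m * (1 / 2) ^ k < \<epsilon> / 2"
    unfolding eventually_sequentially by blast
  hence k: "4 * real m / 2 ^ k < \<epsilon> / 2" by (simp add: power_one_over)
  have "(\<lambda>n. 4 * real m * 2 ^ k / real n) \<longlonglongrightarrow> 0"
    by (rule lim_const_over_n)
  hence "eventually (\<lambda>n. 4 * real m * 2 ^ k / real n < \<epsilon> / 2) sequentially"
    by (rule order_tendstoD) (use \<epsilon> in simp)
  then obtain N where N: "\<And>n. n \<ge> N \<Longrightarrow> 4 * real m * 2 ^ k / real n < \<epsilon> / 2"
    by (auto simp: eventually_sequentially)
  show "\<exists>N. \<forall>n\<ge>N. norm (real (sat_num n m) / real (n * 2 ^ (n - 1)) - 0) < \<epsilon>"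
  \<comment> \<open>The last entry of the maximum makes room for all the blocks.\<close>
  proof (intro exI[of _ "max (max N 1) (2 * (m - 1) * 2 ^ k)"] allI impI)
    fix n assume n: "n \<ge> max (max N 1) (2 * (m - 1) * 2 ^ k)"
    have "real (sat_num n m) / real (n * 2 ^ (n - 1)) < \<epsilon>"
      using sat_num_ratio_le[OF assms, of k n] N[of n] k n by linarith
    thus "norm (real (sat_num n m) / real (n * 2 ^ (n - 1)) - 0) < \<epsilon>" by simp
  qed
qed

end
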